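(* Let $\mathcal{S}=(\mathcal{X},\mathcal{X}_0,w,f)$ be a discrete-time stochastic dynamical system, and let $\mathcal{X}_u\subseteq\mathcal{X}$ be a set of unsafe states. Let $\ell\in\mathbb{N}$, $0\le\gamma\le 1$, and $\alpha_i\in\mathbb{R}_{>0}$ for $0\le i<\ell$. Suppose that functions $\mathcal{B}_i:\mathcal{X}\to\mathbb{R}$, $0\le i\le\ell$, form an interpolation-inspired barrier certificate (IBC) for $\mathcal{S}$ with these constants, that is: \begin{align*} &\mathcal{B}_i(x)\ge 0 && \forall x\in\mathcal{X},\ 0\le i\le\ell,\\ &\mathcal{B}_0(x)\le\gamma && \forall x\in\mathcal{X}_0,\\ &\mathcal{B}_i(x)\ge 1 && \forall x\in\mathcal{X}_u,\ 0\le i\le\ell,\\ &\mathbb{E}[\mathcal{B}_{i+1}(f(x,w))\mid x]\le\alpha_i\mathcal{B}_i(x) && \forall x\in\mathcal{X}\setminus\mathcal{X}_u,\ 0\le i<\ell,\\ &\mathbb{E}[\mathcal{B}_\ell(f(x,w))\mid x]\le\mathcal{B}_\ell(x) && \forall x\in\mathcal{X}\setminus\mathcal{X}_u. \end{align*} Then for every initial state $x_0\in\mathcal{X}_0$, the solution process $\mathbf{x}_{x_0}$ starting from $x_0$ satisfies $$\mathbb{P}\{\mathbf{x}_{x_0}(t)\notin\mathcal{X}_u,\ \forall t\in\mathbb{N}\}\ \ge\ 1-\gamma\left(1+\prod_{i=0}^{\ell-1}\alpha_i+\sum_{t=0}^{\ell-2}\prod_{i=0}^{t}\alpha_i\right)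.$$
   Context: A discrete-time stochastic dynamical system is a tuple $\mathcal{S}=(\mathcal{X},\mathcal{X}_0,w,f)$ where $\mathcal{X}\subseteq\mathbb{R}^n$ is a Borel space (the state set), $\mathcal{X}_0\subseteq\mathcal{X}$ is the set of initial states, $w=\{w(t):\Omega\to\mathcal{W},\ t\in\mathbb{N}\}$ is a sequence of i.i.d. random variables from a probability space $(\Omega,\mathcal{F},\mathbb{P})$ to a measurable space $(\mathcal{W},\mathcal{F}_w)$, and $f:\mathcal{X}\times\mathcal{W}\to\mathcal{X}$ is a measurable map (so $\mathcal{X}$ is forward invariant). The dynamics is $x(t+1)=f(x(t),w(t))$, $t\in\mathbb{N}$, where $\mathbb{N}$ includes $0$. For $x_0\in\mathcal{X}_0$, $\mathbf{x}_{x_0}=(x(0),x(1),\dots)$ denotes the solution process with $x(0)=x_0$, and $\mathbf{x}_{x_0}(t)=x(t)$. For a function $\mathcal{B}$ on $\mathcal{X}$, $\mathbb{E}[\mathcal{B}(f(x,w))\mid x]$ denotes the expectation of $\mathcal{B}(f(x,w))$ over the noise $w$ (distributed as $w(t)$) with the state $x$ fixed. The set $\mathcal{X}_u$ and the functions $\mathcal{B}_i$ are Borel measurable. Empty products equal $1$ and empty sums equal $0$. *)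

theory Defs
  imports "HOL-Probability.Probability"
begin

text \<open>
  The measure \<open>M\<close> is the underlying probability space; \<open>W\<close> is the noise space, used only as a
  measurable space (the measure it carries plays no role). The map \<open>f\<close> is constrained only on
  \<open>X \<times> space W\<close>; measurability into \<open>restrict_space borel X\<close> includes forward invariance of \<open>X\<close>.
\<close>

locale stochastic_system = prob_space M
  for M :: "'o measure" +
  fixes W :: "'w measure"
    and X :: "(real ^ 'n) set"
    and X0 :: "(real ^ 'n) set"
    and w :: "nat \<Rightarrow> 'o \<Rightarrow> 'w"
    and f :: "real ^ 'n \<Rightarrow> 'w \<Rightarrow> real ^ 'n"
  assumes X_borel: "X \<in> sets borel"
    and X0_subset: "X0 \<subseteq> X"
    and w_indep: "indep_vars (\<lambda>_. W) w UNIV"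
    and w_ident: "\<And>t. distr M W (w t) = distr M W (w 0)"
    and f_measurable:
      "(\<lambda>(x, v). f x v) \<in> restrict_space borel X \<Otimes>\<^sub>M W \<rightarrow>\<^sub>M restrict_space borel X"

primrec solution ::
  "('s \<Rightarrow> 'w \<Rightarrow> 's) \<Rightarrow> (nat \<Rightarrow> 'o \<Rightarrow> 'w) \<Rightarrow> 's \<Rightarrow> nat \<Rightarrow> 'o \<Rightarrow> 's" where
  "solution f w x0 0 \<omega> = x0"
| "solution f w x0 (Suc t) \<omega> = f (solution f w x0 t \<omega>) (w t \<omega>)"

text \<open>
  The one-step expectation $E[g(f(x,w)) \mid x]$ of a nonnegative function \<open>g\<close>, with values in
  $[0,\infty]$. The Bochner integral is avoided since it is \<open>0\<close> for non-integrable functions. As the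
  noise is identically distributed, \<open>w 0\<close> represents every \<open>w t\<close>.
\<close>

definition next_expectation ::
  "'o measure \<Rightarrow> (nat \<Rightarrow> 'o \<Rightarrow> 'w) \<Rightarrow> ('s \<Rightarrow> 'w \<Rightarrow> 's) \<Rightarrow> ('s \<Rightarrow> real) \<Rightarrow> 's \<Rightarrow> ennreal" where
  "next_expectation M w f g x = (\<integral>\<^sup>+ \<omega>. ennreal (g (f x (w 0 \<omega>))) \<partial>M)"

definition interpolation_barrier_certificate ::
  "'o measure \<Rightarrow> 's set \<Rightarrow> 's set \<Rightarrow> (nat \<Rightarrow> 'o \<Rightarrow> 'w) \<Rightarrow> ('s \<Rightarrow> 'w \<Rightarrow> 's) \<Rightarrow> 's set \<Rightarrow>
    nat \<Rightarrow> real \<Rightarrow> (nat \<Rightarrow> real) \<Rightarrow> (nat \<Rightarrow> 's \<Rightarrow> real) \<Rightarrow> bool" where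
  "interpolation_barrier_certificate M X X0 w f Xu l \<gamma> \<alpha> B \<longleftrightarrow>
     (\<forall>i\<le>l. \<forall>x\<in>X. B i x \<ge> 0) \<and>
     (\<forall>x\<in>X0. B 0 x \<le> \<gamma>) \<and>
     (\<forall>i\<le>l. \<forall>x\<in>Xu. B i x \<ge> 1) \<and>
     (\<forall>i<l. \<forall>x\<in>X - Xu. next_expectation M w f (B (i + 1)) x \<le> ennreal (\<alpha> i * B i x)) \<and>
     (\<forall>x\<in>X - Xu. next_expectation M w f (B l) x \<le> ennreal (B l x))"

end

theory Submission
  imports Defs
begin

text \<open>
  Put $A_t = \{x(s) \notin X_u \mbox{ for all } s < t\}$. At time $t < l$ use the function $B_t$ and from
  time $l$ on the function $B_l$; write $\beta_t$ for the function in use and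
  $e_t = E[\beta_t(x(t)); A_t]$. As the noise at time $t$ is independent of the past, the certificate
  gives $e_{t+1} \le \alpha_t e_t$ for $t < l$. Since $\beta_t \ge 1$ on $X_u$, the first visit to
  $X_u$ happens at time $t < l$ with probability at most $e_t$. From time $l$ on the sequence is a
  supermartingale, so that visits at time $l$ or later contribute at most $e_l$ in total.
\<close>

text \<open>The state at time \<open>t\<close> reads only the noise at earlier times. The two sample
  points may lie in different spaces, so a solution on \<open>M\<close> can be compared with one
  driven by a recorded noise history.\<close>

lemma solution_cong:
  assumes "\<And>i. i < t \<Longrightarrow> w i \<omega> = w' i \<omega>'"
  shows "solution f w x t \<omega> = solution f w' x t \<omega>'"
  using assms by (induction t) auto

text \<open>By independence the joint law is a product, so Tonelli applies. Both laws are then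
  pulled back to \<open>M\<close>, which gives the inner integral the shape of
  \<open>next_expectation\<close>.\<close>

lemma (in prob_space) nn_integral_indep_var:
  assumes ind: "indep_var S Y T V" and h: "h \<in> borel_measurable (S \<Otimes>\<^sub>M T)"
  shows "(\<integral>\<^sup>+ \<omega>. h (Y \<omega>, V \<omega>) \<partial>M) = (\<integral>\<^sup>+ \<omega>. \<integral>\<^sup>+ \<omega>'. h (Y \<omega>, V \<omega>') \<partial>M \<partial>M)"
proof -
  have rv [measurable]: "Y \<in> measurable M S" "V \<in> measurable M T"
    using ind by (auto simp: indep_var_distribution_eq)
  note h [measurable]
  interpret T: prob_space "distr M T V" by (rule prob_space_distr) measurable
  have "(\<integral>\<^sup>+ \<omega>. h (Y \<omega>, V \<omega>) \<partial>M) = (\<integral>\<^sup>+ p. h p \<partial>distr M (S \<Otimes>\<^sub>M T) (\<lambda>\<omega>. (Y \<omega>, V \<omega>)))"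
    by (simp add: nn_integral_distr)
  also have "\<dots> = (\<integral>\<^sup>+ p. h p \<partial>(distr M S Y \<Otimes>\<^sub>M distr M T V))"
    using ind by (simp add: indep_var_distribution_eq)
  also have "\<dots> = (\<integral>\<^sup>+ y. \<integral>\<^sup>+ v. h (y, v) \<partial>distr M T V \<partial>distr M S Y)"
    by (rule T.nn_integral_fst[symmetric]) measurable
  also have "\<dots> = (\<integral>\<^sup>+ y. \<integral>\<^sup>+ \<omega>'. h (y, V \<omega>') \<partial>M \<partial>distr M S Y)"
    by (intro nn_integral_cong nn_integral_distr) auto
  also have "\<dots> = (\<integral>\<^sup>+ \<omega>. \<integral>\<^sup>+ \<omega>'. h (Y \<omega>, V \<omega>') \<partial>M \<partial>M)"
    by (rule nn_integral_distr) measurable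
  finally show ?thesis .
qed

context stochastic_system
begin

abbreviation R :: "(real ^ 'n) measure" where
  "R \<equiv> restrict_space borel X"

text \<open>Kept general in \<open>N\<close> and \<open>w'\<close> to serve twice: for
  \<open>w\<close> on \<open>M\<close>, and for the coordinate maps on a product space that has only
  finitely many noise coordinates.\<close>

lemma solution_measurable:
  assumes "x0 \<in> X" and "\<And>i. i < t \<Longrightarrow> w' i \<in> N \<rightarrow>\<^sub>M W"
  shows "solution f w' x0 t \<in> N \<rightarrow>\<^sub>M R"
  using assms(2)
proof (induction t)
  case 0
  have "solution f w' x0 0 = (\<lambda>_. x0)" by auto
  then show ?case using assms(1) by (simp add: space_restrict_space)
next
  case (Suc t)
  have "(\<lambda>\<omega>. (solution f w' x0 t \<omega>, w' t \<omega>)) \<in> N \<rightarrow>\<^sub>M R \<Otimes>\<^sub>M W"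
    using Suc by (intro measurable_Pair) auto
  from measurable_compose[OF this f_measurable]
  have "(\<lambda>\<omega>. f (solution f w' x0 t \<omega>) (w' t \<omega>)) \<in> N \<rightarrow>\<^sub>M R" by simp
  also have "(\<lambda>\<omega>. f (solution f w' x0 t \<omega>) (w' t \<omega>)) = solution f w' x0 (Suc t)" by auto
  finally show ?case .
qed

lemma noise_measurable [measurable]: "w t \<in> M \<rightarrow>\<^sub>M W"
  using w_indep by (auto simp: indep_vars_def2)

text \<open>Disjoint blocks of an independent family are independent. The present noise forms a
  block with one index, hence is a function on \<open>{t}\<close> that must later be evaluated at
  \<open>t\<close>.\<close>

lemma past_indep_noise:
  "indep_var (PiM {..<t} (\<lambda>_. W)) (\<lambda>\<omega>. \<lambda>i\<in>{..<t}. w i \<omega>)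
    (PiM {t} (\<lambda>_. W)) (\<lambda>\<omega>. \<lambda>i\<in>{t}. w i \<omega>)"
  by (rule indep_var_restrict[OF w_indep]) auto

lemma nn_integral_noise:
  assumes [measurable]: "h \<in> borel_measurable W"
  shows "(\<integral>\<^sup>+ \<omega>. h (w t \<omega>) \<partial>M) = (\<integral>\<^sup>+ \<omega>. h (w 0 \<omega>) \<partial>M)"
  using nn_integral_distr[of "w t" M W h] nn_integral_distr[of "w 0" M W h] w_ident[of t] by simp

definition safe_before :: "(real ^ 'n) set \<Rightarrow> real ^ 'n \<Rightarrow> nat \<Rightarrow> 'o set" where
  "safe_before Xu x0 t = {\<omega> \<in> space M. \<forall>s<t. solution f w x0 s \<omega> \<notin> Xu}"

text \<open>The state at time \<open>t\<close> and the event
  \<open>safe_before Xu x0 (Suc t)\<close> are functions of the noise before \<open>t\<close>, hence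
  independent of \<open>w t\<close>. With this history fixed, averaging over \<open>w t\<close>
  gives \<open>next_expectation\<close> at the current state, which is safe on the event.\<close>

lemma one_step_expectation_le:
  assumes x0: "x0 \<in> X" and Xu: "Xu \<in> sets borel"
    and g: "g \<in> borel_measurable R"
    and le: "\<And>x. x \<in> X - Xu \<Longrightarrow> next_expectation M w f g x \<le> h x"
  shows "(\<integral>\<^sup>+ \<omega>. ennreal (g (solution f w x0 (Suc t) \<omega>)) * indicator (safe_before Xu x0 (Suc t)) \<omega> \<partial>M)
    \<le> (\<integral>\<^sup>+ \<omega>. h (solution f w x0 t \<omega>) * indicator (safe_before Xu x0 (Suc t)) \<omega> \<partial>M)"
proof -
  note g [measurable]
  define N where "N = PiM {..<t} (\<lambda>_. W)"
  define Y where "Y = (\<lambda>\<omega>. \<lambda>i\<in>{..<t}. w i \<omega>)"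
  \<comment> \<open>The solution as a function of the noise history: the coordinates of a point of
    \<open>N\<close> act as the noise. \<open>S\<close> is the safety event in this picture.\<close>
  define G where "G s = solution f (\<lambda>i \<eta>. \<eta> i) x0 s" for s
  define S where "S = {\<eta> \<in> space N. \<forall>s<Suc t. G s \<eta> \<notin> Xu}"
  have Gm: "G s \<in> N \<rightarrow>\<^sub>M R" if "s \<le> t" for s
    unfolding G_def N_def using that by (intro solution_measurable x0) auto
  have [measurable]: "G t \<in> N \<rightarrow>\<^sub>M R" by (rule Gm) simp
  have GY: "G s (Y \<omega>) = solution f w x0 s \<omega>" if "s \<le> t" for s \<omega>
    unfolding G_def Y_def using that by (intro solution_cong) auto
  have Y [measurable]: "Y \<in> M \<rightarrow>\<^sub>M N" unfolding Y_def N_def by measurable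
  have safe_at: "{\<eta> \<in> space N. G s \<eta> \<notin> Xu} \<in> sets N" if "s \<in> {..<Suc t}" for s
  proof -
    have "G s \<in> borel_measurable N"
      using Gm[of s] that by (simp add: measurable_restrict_space2_iff)
    then have "G s -` (- Xu) \<inter> space N \<in> sets N"
      using Xu by (intro measurable_sets) auto
    also have "G s -` (- Xu) \<inter> space N = {\<eta> \<in> space N. G s \<eta> \<notin> Xu}" by auto
    finally show ?thesis .
  qed
  have "{\<eta> \<in> space N. \<forall>s\<in>{..<Suc t}. G s \<eta> \<notin> Xu} \<in> sets N"
    by (rule sets.sets_Collect_finite_All[OF safe_at finite_lessThan])
  then have [measurable]: "S \<in> sets N" unfolding S_def Ball_def lessThan_iff .
  have "(\<lambda>p. (G t (fst p), snd p t)) \<in> N \<Otimes>\<^sub>M PiM {t} (\<lambda>_. W) \<rightarrow>\<^sub>M R \<Otimes>\<^sub>M W"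
    by measurable
  from measurable_compose[OF this f_measurable]
  have [measurable]: "(\<lambda>p. f (G t (fst p)) (snd p t)) \<in> N \<Otimes>\<^sub>M PiM {t} (\<lambda>_. W) \<rightarrow>\<^sub>M R"
    by simp
  \<comment> \<open>The integrand as a function of the pair of history and present noise; the
    indicator depends on the history alone.\<close>
  define k where "k p = ennreal (g (f (G t (fst p)) (snd p t))) * indicator S (fst p)" for p
  have [measurable]: "k \<in> borel_measurable (N \<Otimes>\<^sub>M PiM {t} (\<lambda>_. W))"
    unfolding k_def by measurable
  have SY: "Y \<omega> \<in> S \<longleftrightarrow> \<omega> \<in> safe_before Xu x0 (Suc t)" if "\<omega> \<in> space M" for \<omega>
    using that measurable_space[OF Y that] GY
    by (auto simp: safe_before_def S_def)
  have "(\<integral>\<^sup>+ \<omega>. ennreal (g (solution f w x0 (Suc t) \<omega>)) * indicator (safe_before Xu x0 (Suc t)) \<omega> \<partial>M)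
      = (\<integral>\<^sup>+ \<omega>. k (Y \<omega>, \<lambda>i\<in>{t}. w i \<omega>) \<partial>M)"
    by (intro nn_integral_cong) (simp add: k_def SY GY indicator_def)
  also have "\<dots> = (\<integral>\<^sup>+ \<omega>. \<integral>\<^sup>+ \<omega>'. k (Y \<omega>, \<lambda>i\<in>{t}. w i \<omega>') \<partial>M \<partial>M)"
  proof (rule nn_integral_indep_var)
    show "indep_var N Y (PiM {t} (\<lambda>_. W)) (\<lambda>\<omega>. \<lambda>i\<in>{t}. w i \<omega>)" unfolding N_def Y_def by (rule past_indep_noise)
  qed measurable
  also have "\<dots> \<le> (\<integral>\<^sup>+ \<omega>. h (solution f w x0 t \<omega>) * indicator (safe_before Xu x0 (Suc t)) \<omega> \<partial>M)"
  proof (rule nn_integral_mono)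
    fix \<omega> assume \<omega>: "\<omega> \<in> space M"
    let ?x = "solution f w x0 t \<omega>"
    have xX: "?x \<in> X"
      using measurable_space[OF solution_measurable[OF x0, of t w M] \<omega>] by (simp add: space_restrict_space)
    have [measurable]: "f ?x \<in> W \<rightarrow>\<^sub>M R"
      using measurable_compose[OF measurable_Pair1' f_measurable, of ?x] xX by (simp add: space_restrict_space)
    have gm: "(\<lambda>v. ennreal (g (f ?x v))) \<in> borel_measurable W" by measurable
    have "(\<integral>\<^sup>+ \<omega>'. ennreal (g (f ?x (w t \<omega>'))) \<partial>M) = next_expectation M w f g ?x"
      unfolding next_expectation_def by (rule nn_integral_noise[OF gm])
    \<comment> \<open>Off the event both sides vanish. On it the current state lies in
      \<open>X - Xu\<close>, so the assumed bound applies.\<close>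
    then show "(\<integral>\<^sup>+ \<omega>'. k (Y \<omega>, \<lambda>i\<in>{t}. w i \<omega>') \<partial>M)
        \<le> h ?x * indicator (safe_before Xu x0 (Suc t)) \<omega>"
      using le[of ?x] xX
      by (cases "\<omega> \<in> safe_before Xu x0 (Suc t)") (simp_all add: k_def GY SY[OF \<omega>] safe_before_def)
  qed
  finally show ?thesis .
qed

end

theorem mainTheorem1:
  fixes M :: "'o measure" and W :: "'w measure"
    and X X0 Xu :: "(real ^ 'n) set"
    and w :: "nat \<Rightarrow> 'o \<Rightarrow> 'w"
    and f :: "real ^ 'n \<Rightarrow> 'w \<Rightarrow> real ^ 'n"
    and l :: nat and \<gamma> :: real and \<alpha> :: "nat \<Rightarrow> real"
    and B :: "nat \<Rightarrow> real ^ 'n \<Rightarrow> real"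
    and x0 :: "real ^ 'n"
  assumes "stochastic_system M W X X0 w f"
    and "Xu \<subseteq> X" and "Xu \<in> sets borel"
    and "0 \<le> \<gamma>" and "\<gamma> \<le> 1"
    and "\<And>i. i < l \<Longrightarrow> \<alpha> i > 0"
    and "\<And>i. i \<le> l \<Longrightarrow> B i \<in> borel_measurable (restrict_space borel X)"
    and "interpolation_barrier_certificate M X X0 w f Xu l \<gamma> \<alpha> B"
    and "x0 \<in> X0"
  shows "\<P>(\<omega> in M. \<forall>t. solution f w x0 t \<omega> \<notin> Xu)
    \<ge> 1 - \<gamma> * (1 + (\<Prod>i<l. \<alpha> i) + (\<Sum>t<l - 1. \<Prod>i\<le>t. \<alpha> i))"
proof -
  interpret stochastic_system M W X X0 w f by fact
  note Xu = \<open>Xu \<in> sets borel\<close>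
  have x0: "x0 \<in> X" using assms(9) X0_subset by auto
  let ?x = "\<lambda>t \<omega>. solution f w x0 t \<omega>"
  define \<beta> where "\<beta> t = B (min t l)" for t
  \<comment> \<open>Extending the factors by 1 merges the two expectation conditions of the
    certificate into the single inequality \<open>\<beta>_step\<close>.\<close>
  define c where "c t = (if t < l then \<alpha> t else 1)" for t
  define A where "A = safe_before Xu x0"
  define e where "e t = (\<integral>\<^sup>+ \<omega>. ennreal (\<beta> t (?x t \<omega>)) * indicator (A t) \<omega> \<partial>M)" for t
  \<comment> \<open>The part of \<open>e t\<close> carried by the paths still safe at time
    \<open>t\<close> itself; the rest of \<open>e t\<close> is carried by \<open>H t\<close>, the
    event that the first visit to \<open>Xu\<close> is at time \<open>t\<close>.\<close>
  define r where "r t = (\<integral>\<^sup>+ \<omega>. ennreal (\<beta> t (?x t \<omega>)) * indicator (A (Suc t)) \<omega> \<partial>M)" for t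
  define H where "H t = A t - A (Suc t)" for t
  note ibc = assms(8)[unfolded interpolation_barrier_certificate_def]
  have c_pos: "c t > 0" for t using assms(6) by (simp add: c_def)
  have \<beta>_nonneg: "\<beta> t x \<ge> 0" if "x \<in> X" for t x using ibc that by (simp add: \<beta>_def)
  have \<beta>_ge1: "\<beta> t x \<ge> 1" if "x \<in> Xu" for t x using ibc that by (simp add: \<beta>_def)
  have \<beta>_step: "next_expectation M w f (\<beta> (Suc t)) x \<le> ennreal (c t) * ennreal (\<beta> t x)"
    if "x \<in> X - Xu" for t x
  proof (cases "t < l")
    case True
    then show ?thesis using ibc that c_pos[of t] \<beta>_nonneg[of x t]
      by (simp add: \<beta>_def c_def ennreal_mult[symmetric])
  next
    case False
    then show ?thesis using ibc that by (simp add: \<beta>_def c_def)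
  qed
  have \<beta>_meas [measurable]: "\<beta> t \<in> borel_measurable R" for t
    using assms(7) by (simp add: \<beta>_def)
  have sol [measurable]: "?x t \<in> M \<rightarrow>\<^sub>M R" for t by (intro solution_measurable x0) simp
  have sol_X: "?x t \<omega> \<in> X" if "\<omega> \<in> space M" for t \<omega>
    using measurable_space[OF sol that] by (simp add: space_restrict_space)
  have sol_borel [measurable]: "?x t \<in> borel_measurable M" for t
    using sol[of t] by (simp add: measurable_restrict_space2_iff)
  note Xu [measurable]
  have A_meas [measurable]: "A t \<in> sets M" for t unfolding A_def safe_before_def by measurable
  have H_meas [measurable]: "H t \<in> sets M" for t unfolding H_def by measurable
  have e_Suc: "e (Suc t) \<le> ennreal (c t) * r t" for t
  proof -
    have "e (Suc t) \<le> (\<integral>\<^sup>+ \<omega>. (ennreal (c t) * ennreal (\<beta> t (?x t \<omega>))) * indicator (A (Suc t)) \<omega> \<partial>M)"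
      unfolding e_def A_def by (rule one_step_expectation_le[OF x0 Xu]) (use \<beta>_step in auto)
    also have "\<dots> = ennreal (c t) * r t"
      by (simp add: r_def mult.assoc nn_integral_cmult)
    finally show ?thesis .
  qed
  \<comment> \<open>\<open>A t\<close> is the disjoint union of \<open>H t\<close> and
    \<open>A (Suc t)\<close>, and on \<open>H t\<close> the state is in \<open>Xu\<close>, where
    \<open>\<beta> t\<close> is at least 1.\<close>
  have first_visit: "emeasure M (H t) + r t \<le> e t" for t
  proof -
    have "emeasure M (H t) + r t
        = (\<integral>\<^sup>+ \<omega>. indicator (H t) \<omega> + ennreal (\<beta> t (?x t \<omega>)) * indicator (A (Suc t)) \<omega> \<partial>M)"
      by (simp add: r_def nn_integral_add)
    also have "\<dots> \<le> e t" unfolding e_def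
    proof (rule nn_integral_mono)
      fix \<omega> assume "\<omega> \<in> space M"
      show "indicator (H t) \<omega> + ennreal (\<beta> t (?x t \<omega>)) * indicator (A (Suc t)) \<omega>
          \<le> ennreal (\<beta> t (?x t \<omega>)) * indicator (A t) \<omega>"
        using \<beta>_ge1[of "?x t \<omega>" t]
        by (auto simp: H_def A_def safe_before_def indicator_def less_Suc_eq)
    qed
    finally show ?thesis .
  qed
  have H_le: "emeasure M (H t) \<le> e t" for t
    by (rule order_trans[OF _ first_visit]) simp
  have "r t \<le> e t" for t
    by (rule order_trans[OF _ first_visit]) simp
  then have e_Suc_le: "e (Suc t) \<le> ennreal (c t) * e t" for t
    using e_Suc[of t] by (meson dual_order.trans mult_left_mono zero_le)
  have e_le: "e t \<le> ennreal (\<gamma> * (\<Prod>i<t. \<alpha> i))" if "t \<le> l" for t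
    using that
  proof (induction t)
    \<comment> \<open>\<open>A 0\<close> is the whole space, \<open>\<beta> 0\<close> is
      \<open>B 0\<close> whatever \<open>l\<close> is, and the total mass is 1.\<close>
    case 0
    have "e 0 \<le> (\<integral>\<^sup>+ \<omega>. ennreal \<gamma> \<partial>M)"
      unfolding e_def by (rule nn_integral_mono)
        (use ibc assms(9) in \<open>auto simp: \<beta>_def indicator_def intro: ennreal_leI\<close>)
    then show ?case by (simp add: emeasure_space_1)
  next
    case (Suc t)
    have "e (Suc t) \<le> ennreal (c t) * ennreal (\<gamma> * (\<Prod>i<t. \<alpha> i))"
      using e_Suc_le[of t] Suc by (meson Suc_leD dual_order.trans mult_left_mono zero_le)
    also have "\<dots> = ennreal (\<gamma> * (\<Prod>i<Suc t. \<alpha> i))"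
      using Suc.prems c_pos[of t] by (subst ennreal_mult'[symmetric]) (auto simp: c_def mult_ac)
    finally show ?case .
  qed
  \<comment> \<open>From time \<open>l\<close> on the factor is 1, so \<open>e_Suc\<close> and
    \<open>first_visit\<close> telescope: each visit probability is paid for by a decrease of
    \<open>e\<close>. The remaining term \<open>e (l + n)\<close> carries the induction.\<close>
  have tail: "(\<Sum>t<n. emeasure M (H (t + l))) + e (l + n) \<le> e l" for n
  proof (induction n)
    case (Suc n)
    have "emeasure M (H (n + l)) + e (l + Suc n) \<le> e (l + n)"
      using e_Suc[of "l + n"] first_visit[of "l + n"]
      by (auto simp: c_def add.commute[of n] intro: order_trans[OF add_left_mono])
    then have "(\<Sum>t<Suc n. emeasure M (H (t + l))) + e (l + Suc n)
        \<le> (\<Sum>t<n. emeasure M (H (t + l))) + e (l + n)"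
      by (simp add: add.assoc add_left_mono)
    with Suc show ?case by (rule order_trans[rotated])
  qed simp
  \<comment> \<open>For positive \<open>l\<close> this is an equality: the empty product at
    \<open>t = 0\<close> is split off and the index shifted. For \<open>l = 0\<close> the left side
    is 0 and the right side is 1, as \<open>l - 1\<close> is truncated to 0.\<close>
  have sum_le: "(\<Sum>t<l. \<Prod>i<t. \<alpha> i) \<le> 1 + (\<Sum>t<l - 1. \<Prod>i\<le>t. \<alpha> i)"
  proof (cases l)
    case (Suc k)
    have "(\<Sum>t<Suc k. \<Prod>i<t. \<alpha> i) = 1 + (\<Sum>t<k. \<Prod>i<Suc t. \<alpha> i)"
      by (subst sum.lessThan_Suc_shift) simp
    then show ?thesis unfolding Suc lessThan_Suc_atMost diff_Suc_1 by (rule eq_refl)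
  qed simp
  have alpha_prod_nonneg: "0 \<le> (\<Prod>i<t. \<alpha> i)" if "t \<le> l" for t
    using that assms(6) by (intro prod_nonneg) (auto intro: less_imp_le)
  have bound_nonneg: "0 \<le> (\<Sum>t<l. \<gamma> * (\<Prod>i<t. \<alpha> i))"
    using assms(4) alpha_prod_nonneg by (intro sum_nonneg mult_nonneg_nonneg) auto
  have "{\<omega> \<in> space M. \<exists>t. ?x t \<omega> \<in> Xu} \<subseteq> (\<Union>t. H t)"
  proof safe
    fix \<omega> t assume "\<omega> \<in> space M" "?x t \<omega> \<in> Xu"
    \<comment> \<open>The least time at which the path is in \<open>Xu\<close> is its first
      visit.\<close>
    then have "\<omega> \<in> H (LEAST t. ?x t \<omega> \<in> Xu)"
      by (auto simp: H_def A_def safe_before_def less_Suc_eq dest: not_less_Least intro: LeastI)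
    then show "\<omega> \<in> (\<Union>t. H t)" by blast
  qed
  then have "emeasure M {\<omega> \<in> space M. \<exists>t. ?x t \<omega> \<in> Xu} \<le> emeasure M (\<Union>t. H t)"
    by (intro emeasure_mono) auto
  also have "\<dots> \<le> (\<Sum>t. emeasure M (H t))"
    by (intro emeasure_subadditive_countably) auto
  \<comment> \<open>The series is cut at \<open>l\<close>: the tail costs \<open>e l\<close> in
    total by telescoping, whereas each earlier visit costs its own \<open>e t\<close>.\<close>
  also have "\<dots> = (\<Sum>t. emeasure M (H (t + l))) + (\<Sum>t<l. emeasure M (H t))"
    by (rule suminf_offset) simp
  also have "\<dots> \<le> e l + (\<Sum>t<l. e t)"
  proof (rule add_mono)
    have "(\<Sum>t<n. emeasure M (H (t + l))) \<le> e l" for n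
      by (rule order_trans[OF _ tail[of n]]) simp
    then show "(\<Sum>t. emeasure M (H (t + l))) \<le> e l" by (intro suminf_le_const) auto
  qed (intro sum_mono H_le)
  also have "\<dots> \<le> ennreal (\<gamma> * (\<Prod>i<l. \<alpha> i)) + (\<Sum>t<l. ennreal (\<gamma> * (\<Prod>i<t. \<alpha> i)))"
    by (intro add_mono sum_mono e_le) auto
  \<comment> \<open>Nonnegativity of all summands lets \<open>ennreal\<close> be pulled out of the
    sums, so that the bound can be read in the reals.\<close>
  also have "\<dots> = ennreal (\<gamma> * (\<Prod>i<l. \<alpha> i) + (\<Sum>t<l. \<gamma> * (\<Prod>i<t. \<alpha> i)))"
    using assms(4) alpha_prod_nonneg bound_nonneg by (subst sum_ennreal) auto
  finally have "\<P>(\<omega> in M. \<exists>t. ?x t \<omega> \<in> Xu) \<le> \<gamma> * (\<Prod>i<l. \<alpha> i) + (\<Sum>t<l. \<gamma> * (\<Prod>i<t. \<alpha> i))"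
    using assms(4) alpha_prod_nonneg bound_nonneg
    by (simp add: emeasure_eq_measure del: ennreal_plus)
  also have "\<dots> = \<gamma> * ((\<Prod>i<l. \<alpha> i) + (\<Sum>t<l. \<Prod>i<t. \<alpha> i))"
    by (simp add: sum_distrib_left distrib_left)
  also have "\<dots> \<le> \<gamma> * (1 + (\<Prod>i<l. \<alpha> i) + (\<Sum>t<l - 1. \<Prod>i\<le>t. \<alpha> i))"
    using sum_le assms(4) by (intro mult_left_mono) auto
  finally show ?thesis
    using prob_neg[of "\<lambda>\<omega>. \<exists>t. ?x t \<omega> \<in> Xu"] by simp
qed

end
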